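(* Let $G=(V,E)$ be a finite connected undirected graph with $n=|V|$ vertices and a designated sink vertex, modelling a wireless sensor network. The worst-case time complexity (network wide) of the Distributed Vertex Cover Algorithm with Breadth-First Search Tree run on $G$ is $O(n)$.
   Context: Network model: vertices are identical nodes with unique identifiers, edges are unweighted communication links, each node knows its neighbors, and nodes are time-synchronized. Distributed Vertex Cover Algorithm with Breadth-First Search (BFS) Tree, consisting of two rounds. Round 1 (asynchronous BFS construction): the sink has level $0$ and all other nodes initially have level $\infty$; the sink sends an "infrastructure" message carrying level $0$ to all its neighbors. A node receiving an infrastructure message from a sender of level $\ell$ checks whether its own level exceeds $\ell+1$; if so, it sets its level to $\ell+1$, sets its parent to the sender, and sends an infrastructure message with its new level to all its neighbors except the sender. Round 2 (started after round 1 has stabilized): every node sends its level to all its neighbors. Then each node decides: a node of even level enters the vertex cover set; for each pair of adjacent nodes both of odd level, the one with the higher identifier enters the vertex cover set. Time convention: the time complexity is the worst-case number of time units until termination, where a node sending a message to its neighbors takes one time unit. *)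

theory Defs
  imports
    "Graph_Theory.Digraph_Component"
    "HOL-Library.Extended_Nat"
    "HOL-Library.Extended_Nonnegative_Real"
    "HOL-Library.Landau_Symbols"
    "HOL-Library.Multiset"
begin

text \<open>
  A vertex is its own identifier, so identifiers are pairwise distinct natural numbers. An
  undirected edge is a pair of opposite arcs.
\<close>

locale sensor_network = pair_graph G
  for G :: "nat pair_pre_digraph" +
  fixes sink :: nat
  assumes connected: "Digraph_Component.connected (with_proj G)"
    and sink: "sink \<in> pverts G"

definition neighbors :: "nat pair_pre_digraph \<Rightarrow> nat \<Rightarrow> nat set" where
  "neighbors G v = {u. (v, u) \<in> parcs G}"

datatype content = Infrastructure nat | Level enat

datatype message =
  Message (sender: nat) (receiver: nat) (content: content) (sent_at: real)

text \<open>
  The field \<open>heard\<close> maps each neighbor to the level it reported in round 2;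
  \<open>in_cover\<close> is \<open>None\<close> until the node has decided.
\<close>

record node =
  level :: enat
  parent :: "nat option"
  heard :: "nat \<Rightarrow> enat option"
  in_cover :: "bool option"

record config =
  round_two :: bool
  node :: "nat \<Rightarrow> node"
  transit :: "message multiset"
  clock :: real

definition send :: "nat \<Rightarrow> nat set \<Rightarrow> content \<Rightarrow> real \<Rightarrow> message multiset" where
  "send v U x t = image_mset (\<lambda>u. Message v u x t) (mset_set U)"

definition even_level :: "enat \<Rightarrow> bool" where
  "even_level l \<longleftrightarrow> (\<exists>k. l = enat k \<and> even k)"

definition odd_level :: "enat \<Rightarrow> bool" where
  "odd_level l \<longleftrightarrow> (\<exists>k. l = enat k \<and> odd k)"

definition decision :: "nat pair_pre_digraph \<Rightarrow> nat \<Rightarrow> node \<Rightarrow> bool" where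
  "decision G v q \<longleftrightarrow>
     even_level (level q) \<or>
     odd_level (level q) \<and>
       (\<exists>u \<in> neighbors G v. \<exists>l. heard q u = Some l \<and> odd_level l \<and> u < v)"

definition initial :: "nat pair_pre_digraph \<Rightarrow> nat \<Rightarrow> config" where
  "initial G s =
     \<lparr> round_two = False,
       node = (\<lambda>v. \<lparr> level = (if v = s then 0 else \<infinity>), parent = None,
                     heard = (\<lambda>_. None), in_cover = None \<rparr>),
       transit = send s (neighbors G s) (Infrastructure 0) 0,
       clock = 0 \<rparr>"

text \<open>
  Asynchronous links with the time unit as the bound on transmission delays: a message sent at
  time \<open>t\<close> arrives at an arbitrary time in \<open>{t<..t + 1}\<close>. Links need not be FIFO. The last
  conjunct keeps the clock from passing the latest arrival time of any message in transit.
\<close>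

definition can_arrive :: "config \<Rightarrow> message \<Rightarrow> real \<Rightarrow> bool" where
  "can_arrive c m t \<longleftrightarrow>
     m \<in># transit c \<and> clock c \<le> t \<and> sent_at m < t \<and>
     (\<forall>m' \<in># transit c. t \<le> sent_at m' + 1)"

text \<open>
  Local computation is free: only message arrivals advance the clock. Round 1 has stabilized as
  soon as no infrastructure message is in transit; the synchronized nodes then start round 2
  without delay.
\<close>

inductive step :: "nat pair_pre_digraph \<Rightarrow> config \<Rightarrow> config \<Rightarrow> bool"
  for G :: "nat pair_pre_digraph" where
  adopt:
    "step G c (c\<lparr> node := (node c)(v := (node c v)\<lparr> level := enat (l + 1), parent := Some u \<rparr>),
                 transit := transit c - {#m#}
                   + send v (neighbors G v - {u}) (Infrastructure (l + 1)) t,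
                 clock := t \<rparr>)"
    if "can_arrive c m t" "m = Message u v (Infrastructure l) t0" "level (node c v) > enat (l + 1)"
| ignore:
    "step G c (c\<lparr> transit := transit c - {#m#}, clock := t \<rparr>)"
    if "can_arrive c m t" "m = Message u v (Infrastructure l) t0" "\<not> level (node c v) > enat (l + 1)"
| start_round_two:
    "step G c (c\<lparr> round_two := True,
                 transit := (\<Sum>v \<in> pverts G.
                   send v (neighbors G v) (Level (level (node c v))) (clock c)) \<rparr>)"
    if "\<not> round_two c" "transit c = {#}"
| hear:
    "step G c (c\<lparr> node := (node c)(v := (node c v)\<lparr> heard := (heard (node c v))(u := Some l) \<rparr>),
                 transit := transit c - {#m#},
                 clock := t \<rparr>)"
    if "can_arrive c m t" "m = Message u v (Level l) t0"
| decide: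
    "step G c (c\<lparr> node := (node c)(v := (node c v)\<lparr> in_cover := Some (decision G v (node c v)) \<rparr>) \<rparr>)"
    if "round_two c" "v \<in> pverts G" "in_cover (node c v) = None"
       "\<forall>u \<in> neighbors G v. heard (node c v) u \<noteq> None"

definition terminated :: "nat pair_pre_digraph \<Rightarrow> config \<Rightarrow> bool" where
  "terminated G c \<longleftrightarrow>
     round_two c \<and> transit c = {#} \<and> (\<forall>v \<in> pverts G. in_cover (node c v) \<noteq> None)"

text \<open>Maximal executions; one that gets stuck repeats its last configuration forever.\<close>

definition execution :: "nat pair_pre_digraph \<Rightarrow> nat \<Rightarrow> (nat \<Rightarrow> config) \<Rightarrow> bool" where
  "execution G s \<sigma> \<longleftrightarrow>
     \<sigma> 0 = initial G s \<and>
     (\<forall>i. step G (\<sigma> i) (\<sigma> (Suc i)) \<or> (\<nexists>c. step G (\<sigma> i) c) \<and> \<sigma> (Suc i) = \<sigma> i)"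

definition running_time :: "nat pair_pre_digraph \<Rightarrow> (nat \<Rightarrow> config) \<Rightarrow> ennreal" where
  "running_time G \<sigma> =
     (if \<exists>i. terminated G (\<sigma> i)
      then ennreal (clock (\<sigma> (LEAST i. terminated G (\<sigma> i))))
      else \<infinity>)"

definition worst_case_time :: "nat \<Rightarrow> ennreal" where
  "worst_case_time n =
     (SUP (G, s, \<sigma>) \<in> {(G, s, \<sigma>). sensor_network G s \<and> card (pverts G) = n \<and> execution G s \<sigma>}.
        running_time G \<sigma>)"

end

theory Submission
  imports Defs "HOL-Library.Multiset_Order"
begin

text \<open>
  In round 1 a vertex at depth \<open>d\<close> has its final level as soon as the clock exceeds \<open>d\<close>: a
  shortest path delivers its wave of levels with at most one time unit per edge. So a vertex
  adopts, and hence sends, only up to time \<open>d\<close>, and the last arrival of round 1 happens by time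
  \<open>(n - 1) + 1\<close>. Round 2 takes one more time unit, so the running time is at most \<open>n + 1\<close>.
  Executions are finite: an adoption decreases the multiset of levels, and every other step
  starts round 2, consumes a message or decides a vertex.
\<close>

section \<open>Messages in transit\<close>

lemma mem_send_iff:
  "finite U \<Longrightarrow> Message a b y t' \<in># send v U x t \<longleftrightarrow> a = v \<and> b \<in> U \<and> y = x \<and> t' = t"
  by (auto simp: send_def)

lemma mem_diff_single_iff: "x \<noteq> m \<Longrightarrow> x \<in># M - {#m#} \<longleftrightarrow> x \<in># M"
  by (simp add: in_diff_count count_greater_zero_iff[symmetric] del: count_greater_zero_iff)

lemma can_arriveD:
  assumes "can_arrive c m t"
  shows "m \<in># transit c" "clock c \<le> t" "sent_at m < t"
    "Message u v x t0 \<in># transit c \<Longrightarrow> t \<le> t0 + 1"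
  using assms unfolding can_arrive_def by force+

section \<open>Distances from the sink\<close>

context sensor_network
begin

lemma finite_neighbors [simp]: "finite (neighbors G v)"
proof -
  have "neighbors G v \<subseteq> snd ` parcs G"
    unfolding neighbors_def by force
  then show ?thesis
    using pair_finite_arcs by (meson finite_imageI finite_subset)
qed

lemma mem_neighbors [simp]: "u \<in> neighbors G v \<longleftrightarrow> (v, u) \<in> parcs G"
  by (simp add: neighbors_def)

lemma finite_verts [simp]: "finite (pverts G)"
  by (rule pair_finite_verts)

lemma arc_sym: "(u, v) \<in> parcs G \<Longrightarrow> (v, u) \<in> parcs G"
  using pair_sym_arcs unfolding symmetric_def by (auto dest: symD)

lemma arc_in_verts: "(u, v) \<in> parcs G \<Longrightarrow> u \<in> pverts G \<and> v \<in> pverts G"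
  using arc_fst_in_verts arc_snd_in_verts by fastforce

text \<open>Breadth-first distance from the sink. Outside the graph the value is arbitrary; the
  lower bound on levels stays true there, since such levels remain \<infinity>.\<close>

definition depth :: "nat \<Rightarrow> nat" where
  "depth v = (LEAST k. (sink, v) \<in> parcs G ^^ k)"

lemma reachable_by_depth:
  assumes "v \<in> pverts G"
  shows "(sink, v) \<in> parcs G ^^ depth v"
proof -
  \<comment> \<open>Arcs come in opposite pairs, so weak connectivity already gives directed paths
    from the sink.\<close>
  have "strongly_connected (with_proj G)"
    using connected pair_sym_arcs symmetric_connected_imp_strongly_connected by blast
  then have "sink \<rightarrow>\<^sup>*\<^bsub>with_proj G\<^esub> v"
    using assms sink by (auto simp: strongly_connected_def)
  then have "(sink, v) \<in> (parcs G)\<^sup>*"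
    using reachable_rtranclI by fastforce
  then show ?thesis
    unfolding depth_def by (auto intro: LeastI dest: rtrancl_imp_relpow)
qed

lemma depth_le: "(sink, v) \<in> parcs G ^^ k \<Longrightarrow> depth v \<le> k"
  unfolding depth_def by (rule Least_le)

lemma depth_sink [simp]: "depth sink = 0"
  using depth_le[of sink 0] by simp

lemma depth_arc:
  assumes "(u, v) \<in> parcs G"
  shows "depth v \<le> depth u + 1"
proof -
  have "(sink, v) \<in> parcs G ^^ Suc (depth u)"
    using reachable_by_depth assms arc_in_verts by (meson relpow_Suc_I)
  then show ?thesis
    using depth_le by fastforce
qed

lemma obtain_predecessor:
  assumes "v \<in> pverts G" "depth v = Suc k"
  obtains u where "(u, v) \<in> parcs G" "depth u = k"
proof -
  obtain u where u: "(sink, u) \<in> parcs G ^^ k" "(u, v) \<in> parcs G"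
    using reachable_by_depth[OF assms(1)] assms(2) by auto
  \<comment> \<open>The path to \<open>u\<close> gives \<open>depth u \<le> k\<close>; the arc to
    \<open>v\<close> gives the converse bound.\<close>
  then have "depth u = k"
    using depth_le[OF u(1)] depth_arc[OF u(2)] assms(2) by simp
  then show ?thesis
    using that u by blast
qed

text \<open>A shortest path to \<open>v\<close> meets every depth from 0 to \<open>depth v\<close>,
  so there are at least \<open>depth v + 1\<close> vertices. This turns time bounds in terms of
  depth into bounds in terms of n.\<close>

lemma depth_less_card:
  assumes "v \<in> pverts G"
  shows "depth v < card (pverts G)"
proof -
  have "v \<in> pverts G \<Longrightarrow> {..depth v} \<subseteq> depth ` pverts G" for v
  proof (induction "depth v" arbitrary: v)
    case 0
    then show ?case by force
  next
    case (Suc k)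
    then obtain u where "(u, v) \<in> parcs G" "depth u = k"
      using obtain_predecessor by metis
    then have "{..k} \<subseteq> depth ` pverts G"
      using Suc.hyps(1)[of u] arc_in_verts by auto
    moreover have "depth v \<in> depth ` pverts G"
      using Suc.prems by blast
    ultimately show ?case
      by (simp flip: Suc.hyps(2) add: atMost_Suc)
  qed
  from this[OF assms] have "card {..depth v} \<le> card (depth ` pverts G)"
    by (intro card_mono) auto
  also have "\<dots> \<le> card (pverts G)"
    by (intro card_image_le) auto
  finally show ?thesis by simp
qed

section \<open>Invariants\<close>

text \<open>Common to both rounds. The upper bound on the clock says that no delivery deadline has
  been missed, which later guarantees that some message can still arrive.\<close>

definition links_ok :: "config \<Rightarrow> bool" where
  "links_ok c \<longleftrightarrow> (\<forall>u v x t. Message u v x t \<in># transit c \<longrightarrow>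
     (u, v) \<in> parcs G \<and> t \<le> clock c \<and> clock c \<le> t + 1)"

text \<open>A sender may have lowered its level after sending, hence the inequality between its
  level and \<open>l\<close>. The bound \<open>t \<le> depth u\<close> is the source of the linear
  time. The last clause says that for every arc the current level of the tail has either taken
  effect at the head or is on its way there.\<close>

definition round_one_ok :: "config \<Rightarrow> bool" where
  "round_one_ok c \<longleftrightarrow>
     clock c \<le> card (pverts G) \<and> level (node c sink) = 0 \<and>
     (\<forall>v. enat (depth v) \<le> level (node c v)) \<and>
     (\<forall>u v x t. Message u v x t \<in># transit c \<longrightarrow>
        (\<exists>l. x = Infrastructure l \<and> depth u \<le> l \<and> level (node c u) \<le> enat l \<and> t \<le> depth u)) \<and>
     (\<forall>u v k. (u, v) \<in> parcs G \<longrightarrow> level (node c u) = enat k \<longrightarrow>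
        level (node c v) \<le> enat (k + 1) \<or> (\<exists>t. Message u v (Infrastructure k) t \<in># transit c))"

text \<open>Round 2 starts by time \<open>card (pverts G)\<close> and its messages need one more
  unit. The last clause ensures that every vertex can decide once nothing is in transit.\<close>

definition round_two_ok :: "config \<Rightarrow> bool" where
  "round_two_ok c \<longleftrightarrow>
     clock c \<le> card (pverts G) + 1 \<and>
     (\<forall>u v x t. Message u v x t \<in># transit c \<longrightarrow> (\<exists>l. x = Level l) \<and> t \<le> card (pverts G)) \<and>
     (\<forall>u v. (u, v) \<in> parcs G \<longrightarrow>
        heard (node c v) u \<noteq> None \<or> (\<exists>l t. Message u v (Level l) t \<in># transit c))"

definition config_ok :: "config \<Rightarrow> bool" where
  "config_ok c \<longleftrightarrow> links_ok c \<and> (if round_two c then round_two_ok c else round_one_ok c)"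

lemma round_one_message:
  assumes "round_one_ok c" "Message u v x t \<in># transit c"
  obtains l where "x = Infrastructure l" "depth u \<le> l" "level (node c u) \<le> enat l" "t \<le> depth u"
  using assms unfolding round_one_ok_def by blast

lemma round_two_message:
  assumes "round_two_ok c" "Message u v x t \<in># transit c"
  obtains l where "x = Level l" "t \<le> card (pverts G)"
  using assms unfolding round_two_ok_def by blast

text \<open>The arrival rules of \<open>step\<close> do not test the round; under the invariant the
  content of a message determines it.\<close>

lemma infrastructure_imp_round_one:
  "config_ok c \<Longrightarrow> Message u v (Infrastructure l) t \<in># transit c \<Longrightarrow> \<not> round_two c"
  unfolding config_ok_def round_two_ok_def by (metis content.distinct(1))

lemma level_imp_round_two:
  "config_ok c \<Longrightarrow> Message u v (Level l) t \<in># transit c \<Longrightarrow> round_two c"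
  unfolding config_ok_def round_one_ok_def by (metis content.distinct(1))

text \<open>Induction along a shortest path. The predecessor \<open>u\<close> has settled at level
  \<open>k\<close> and sent it by time \<open>k\<close>; if that message were still in transit, the
  next arrival time \<open>t\<close> could not exceed \<open>k + 1 = depth v\<close>. So it has been
  delivered and \<open>v\<close> has level at most \<open>k + 1\<close>.\<close>

lemma level_settled:
  fixes t :: real
  assumes ok: "round_one_ok c" and arrive: "can_arrive c m t"
    and v: "v \<in> pverts G" and late: "depth v < t"
  shows "level (node c v) = enat (depth v)"
  using v late
proof (induction "depth v" arbitrary: v)
  case 0
  then have "v = sink"
    using reachable_by_depth by force
  then show ?case
    using ok by (simp add: round_one_ok_def zero_enat_def)
next
  case (Suc k)
  then obtain u where u: "(u, v) \<in> parcs G" "depth u = k"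
    using obtain_predecessor by metis
  then have lu: "level (node c u) = enat k"
    using Suc arc_in_verts by fastforce
  have "False" if "Message u v (Infrastructure k) t0 \<in># transit c" for t0
  proof -
    have "t \<le> t0 + 1" "t0 \<le> k"
      using can_arriveD(4)[OF arrive that] that ok u(2) by (auto elim: round_one_message)
    then show False
      using Suc.prems Suc.hyps(2) by linarith
  qed
  then have "level (node c v) \<le> enat (k + 1)"
    using ok u(1) lu unfolding round_one_ok_def by blast
  moreover have "enat (depth v) \<le> level (node c v)"
    using ok unfolding round_one_ok_def by blast
  ultimately show ?case
    using Suc.hyps(2) by simp
qed

section \<open>Establishing and preserving the invariants\<close>

lemma config_ok_initial: "config_ok (initial G sink)"
  using depth_less_card[OF sink]
  by (auto simp: config_ok_def initial_def links_ok_def round_one_ok_def mem_send_iff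
      zero_enat_def)

text \<open>The clock only moves forward to \<open>t\<close>, and \<open>can_arrive\<close> keeps
  \<open>t\<close> within the deadline of every message in transit.\<close>

lemma links_ok_arrival:
  assumes "links_ok c" "can_arrive c m t"
    and "Message u v x t' \<in># transit c - {#m#}"
  shows "(u, v) \<in> parcs G \<and> t' \<le> t \<and> t \<le> t' + 1"
proof -
  have "Message u v x t' \<in># transit c"
    using assms(3) by (rule in_diffD)
  then show ?thesis
    using assms(1) can_arriveD(2,4)[OF assms(2)] unfolding links_ok_def by fastforce
qed

text \<open>The crucial point is that \<open>v\<close> adopts no later than time
  \<open>depth v\<close>: afterwards its level is already \<open>depth v \<le> l + 1\<close> and
  cannot drop to \<open>l + 1\<close>. So the new messages respect the bound on sending
  times.\<close>

lemma round_one_ok_adopt: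
  assumes ok: "round_one_ok c" and links: "links_ok c"
    and arrive: "can_arrive c m t" and m: "m = Message u v (Infrastructure l) t0"
    and lower: "level (node c v) > enat (l + 1)"
  shows "round_one_ok (c\<lparr> node := (node c)(v := (node c v)\<lparr> level := enat (l + 1), parent := Some u \<rparr>),
           transit := transit c - {#m#}
             + send v (neighbors G v - {u}) (Infrastructure (l + 1)) t,
           clock := t \<rparr>)" (is "round_one_ok ?c")
proof -
  have m_in: "Message u v (Infrastructure l) t0 \<in># transit c"
    using can_arriveD(1)[OF arrive] m by simp
  then have uv: "(u, v) \<in> parcs G"
    using links unfolding links_ok_def by blast
  have l: "depth u \<le> l" "level (node c u) \<le> enat l" "t0 \<le> depth u"
    using round_one_message[OF ok m_in] by auto
  have dv: "depth v \<le> l + 1"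
    using depth_arc[OF uv] l(1) by linarith
  have "t \<le> t0 + 1"
    using can_arriveD(4)[OF arrive m_in] .
  \<comment> \<open>\<open>t \<le> depth u + 1\<close>, and \<open>depth u\<close> is strictly below
    the number of vertices.\<close>
  then have clock: "t \<le> card (pverts G)"
    using l(3) depth_less_card[of u] arc_in_verts[OF uv] by linarith
  have early: "t \<le> depth v"
  proof (rule ccontr)
    assume "\<not> t \<le> depth v"
    then have "level (node c v) = enat (depth v)"
      using level_settled[OF ok arrive] arc_in_verts[OF uv] by auto
    then show False
      using lower dv by simp
  qed
  have mono: "level (node ?c w) \<le> level (node c w)" for w
    using lower by (simp add: less_imp_le)
  have sink_level: "level (node ?c sink) = 0"
    using ok lower by (auto simp: round_one_ok_def)
  have depth: "enat (depth w) \<le> level (node ?c w)" for w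
    using ok dv by (auto simp: round_one_ok_def)
  have msgs: "\<exists>l'. x = Infrastructure l' \<and> depth a \<le> l' \<and> level (node ?c a) \<le> enat l' \<and> t' \<le> depth a"
    if "Message a b x t' \<in># transit ?c" for a b x t'
  proof -
    from that consider "Message a b x t' \<in># transit c" | "a = v" "x = Infrastructure (l + 1)" "t' = t"
      by (auto simp: mem_send_iff dest: in_diffD)
    then show ?thesis
    proof cases
      case 1
      then show ?thesis
        using round_one_message[OF ok 1] mono order_trans by metis
    next
      case 2
      then show ?thesis
        using dv early by simp
    qed
  qed
  have waves: "level (node ?c b) \<le> enat (k + 1) \<or> (\<exists>t. Message a b (Infrastructure k) t \<in># transit ?c)"
    if ab: "(a, b) \<in> parcs G" and k: "level (node ?c a) = enat k" for a b k
  proof (cases "a = v")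
    case True
    then have "k = l + 1"
      using k by simp
    show ?thesis
    proof (cases "b = u")
      \<comment> \<open>Nothing is sent back to \<open>u\<close>, but its level is at most
        \<open>l\<close>, so it has no use for \<open>l + 2\<close>.\<close>
      case b: True
      have "level (node ?c u) \<le> enat l"
        using mono[of u] l(2) by (rule order_trans)
      also have "\<dots> \<le> enat (k + 1)"
        using \<open>k = l + 1\<close> by simp
      finally show ?thesis
        using b by blast
    next
      case False
      then show ?thesis
        using True ab \<open>k = l + 1\<close> by (auto simp: mem_send_iff)
    qed
  next
    case False
    then have "level (node c a) = enat k"
      using k by simp
    then consider "level (node c b) \<le> enat (k + 1)"
      | t' where "Message a b (Infrastructure k) t' \<in># transit c"
      using ok ab unfolding round_one_ok_def by blast
    then show ?thesis
    proof cases
      case 1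
      then show ?thesis
        using mono order_trans by blast
    next
      case 2
      show ?thesis
      proof (cases "Message a b (Infrastructure k) t' = m")
        \<comment> \<open>The message just consumed: here \<open>b = v\<close> and
          \<open>k = l\<close>, so the adopted level meets the first alternative.\<close>
        case True
        then show ?thesis
          using m by simp
      next
        case False
        then have "Message a b (Infrastructure k) t' \<in># transit ?c"
          using 2 by (simp add: mem_diff_single_iff)
        then show ?thesis
          by blast
      qed
    qed
  qed
  show ?thesis
    unfolding round_one_ok_def
    using clock sink_level depth msgs waves by auto
qed

lemma round_one_ok_ignore:
  assumes ok: "round_one_ok c" and links: "links_ok c"
    and arrive: "can_arrive c m t" and m: "m = Message u v (Infrastructure l) t0"
    and not_lower: "\<not> level (node c v) > enat (l + 1)"
  shows "round_one_ok (c\<lparr> transit := transit c - {#m#}, clock := t \<rparr>)" (is "round_one_ok ?c")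
proof -
  have m_in: "Message u v (Infrastructure l) t0 \<in># transit c"
    using can_arriveD(1)[OF arrive] m by simp
  then have "u \<in> pverts G"
    using links arc_in_verts unfolding links_ok_def by blast
  moreover have "t \<le> t0 + 1" "t0 \<le> depth u"
    using can_arriveD(4)[OF arrive m_in] round_one_message[OF ok m_in] by auto
  ultimately have "t \<le> card (pverts G)"
    using depth_less_card[of u] by linarith
  moreover have "level (node c b) \<le> enat (k + 1) \<or> (\<exists>t. Message a b (Infrastructure k) t \<in># transit ?c)"
    if ab: "(a, b) \<in> parcs G" and k: "level (node c a) = enat k" for a b k
  proof (cases "level (node c b) \<le> enat (k + 1)")
    case False
    then obtain t' where t': "Message a b (Infrastructure k) t' \<in># transit c"
      using ok ab k False unfolding round_one_ok_def by blast
    \<comment> \<open>Otherwise \<open>b = v\<close> and \<open>k = l\<close>, and \<open>m\<close>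
      was ignored because the level of \<open>b\<close> is at most \<open>k + 1\<close>, against the
      case assumption.\<close>
    moreover have "Message a b (Infrastructure k) t' \<noteq> m"
      using False not_lower m by auto
    ultimately have "Message a b (Infrastructure k) t' \<in># transit ?c"
      by (simp add: mem_diff_single_iff)
    then show ?thesis
      by blast
  qed simp
  ultimately show ?thesis
    using ok unfolding round_one_ok_def by (auto dest!: in_diffD)
qed

lemma config_ok_step:
  assumes "step G c c'" "config_ok c"
  shows "config_ok c'"
  using assms
proof cases
  case (adopt m t u v l t0)
  have links: "links_ok c"
    using assms(2) by (simp add: config_ok_def)
  have r: "\<not> round_two c"
    using can_arriveD(1)[OF adopt(2)] adopt(3) assms(2) infrastructure_imp_round_one by blast
  then have ok: "round_one_ok c"
    using assms(2) by (simp add: config_ok_def)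
  have "links_ok c'"
    unfolding links_ok_def
    using links_ok_arrival[OF links adopt(2)]
    by (auto simp: adopt(1) mem_send_iff)
  then show ?thesis
    using round_one_ok_adopt[OF ok links adopt(2-4)] r
    by (simp add: config_ok_def adopt(1))
next
  case (ignore m t u v l t0)
  have links: "links_ok c"
    using assms(2) by (simp add: config_ok_def)
  have r: "\<not> round_two c"
    using can_arriveD(1)[OF ignore(2)] ignore(3) assms(2) infrastructure_imp_round_one by blast
  then have ok: "round_one_ok c"
    using assms(2) by (simp add: config_ok_def)
  have "links_ok c'"
    unfolding links_ok_def
    using links_ok_arrival[OF links ignore(2)]
    by (auto simp: ignore(1))
  then show ?thesis
    using round_one_ok_ignore[OF ok links ignore(2-4)] r
    by (simp add: config_ok_def ignore(1))
next
  case start_round_two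
  then have "clock c \<le> card (pverts G)"
    using assms(2) by (simp add: config_ok_def round_one_ok_def)
  \<comment> \<open>Exactly one message per arc is in transit, sent at the current clock, so every
    neighbor still to be heard has its report under way.\<close>
  moreover have "Message a b x t \<in># transit c' \<longleftrightarrow>
      (a, b) \<in> parcs G \<and> x = Level (level (node c a)) \<and> t = clock c" for a b x t
    by (auto simp: start_round_two(1) set_mset_sum mem_send_iff dest: arc_in_verts)
  ultimately show ?thesis
    unfolding config_ok_def links_ok_def round_two_ok_def
    by (simp add: start_round_two(1))
next
  case (hear m t u v l t0)
  have links: "links_ok c"
    using assms(2) by (simp add: config_ok_def)
  have m_in: "Message u v (Level l) t0 \<in># transit c"
    using can_arriveD(1)[OF hear(2)] hear(3) by simp
  then have r: "round_two c"
    using assms(2) level_imp_round_two by blast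
  then have ok: "round_two_ok c"
    using assms(2) by (simp add: config_ok_def)
  have "t \<le> t0 + 1" "t0 \<le> card (pverts G)"
    using can_arriveD(4)[OF hear(2) m_in] round_two_message[OF ok m_in] by auto
  then have "t \<le> card (pverts G) + 1"
    by linarith
  moreover have "heard (node c' b) a \<noteq> None \<or> (\<exists>l t. Message a b (Level l) t \<in># transit c')"
    if ab: "(a, b) \<in> parcs G" for a b
  proof (cases "heard (node c b) a = None")
    case True
    then obtain l' t' where t': "Message a b (Level l') t' \<in># transit c"
      using ok ab unfolding round_two_ok_def by blast
    show ?thesis
    proof (cases "Message a b (Level l') t' = m")
      case True
      then show ?thesis
        using hear(1,3) by simp
    next
      case False
      then have "Message a b (Level l') t' \<in># transit c'"
        using t' hear(1) by (simp add: mem_diff_single_iff)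
      then show ?thesis
        by blast
    qed
  qed (auto simp: hear(1))
  moreover have "(\<exists>l. x = Level l) \<and> t' \<le> card (pverts G)"
    if "Message a b x t' \<in># transit c'" for a b x t'
    using that ok by (auto simp: hear(1) round_two_ok_def dest!: in_diffD)
  ultimately have "round_two_ok c'"
    unfolding round_two_ok_def by (auto simp: hear(1))
  moreover have "links_ok c'"
    unfolding links_ok_def
    using links_ok_arrival[OF links hear(2)]
    by (auto simp: hear(1))
  ultimately show ?thesis
    using r by (simp add: config_ok_def hear(1))
next
  case (decide v)
  then show ?thesis
    using assms(2) by (auto simp: config_ok_def links_ok_def round_two_ok_def)
qed

lemma clock_bound: "config_ok c \<Longrightarrow> clock c \<le> card (pverts G) + 1"
  by (auto simp: config_ok_def round_two_ok_def round_one_ok_def split: if_splits)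

section \<open>Termination\<close>

text \<open>A message sent earliest can arrive exactly one unit after its sending: all other
  deadlines are at least as late, and the clock has not passed this one.\<close>

lemma message_can_arrive:
  assumes "links_ok c" "transit c \<noteq> {#}"
  obtains m t where "can_arrive c m t"
proof -
  let ?S = "sent_at ` set_mset (transit c)"
  have "Min ?S \<in> ?S"
    using assms(2) by (intro Min_in) auto
  then obtain m where m: "m \<in># transit c" "sent_at m = Min ?S"
    by auto
  have "clock c \<le> sent_at m + 1"
    using assms(1) m(1) unfolding links_ok_def by (cases m) auto
  moreover have "sent_at m \<le> sent_at m'" if "m' \<in># transit c" for m'
    using that by (auto simp: m(2))
  ultimately have "can_arrive c m (sent_at m + 1)"
    using m(1) by (simp add: can_arrive_def)
  then show ?thesis
    by (rule that)
qed

text \<open>No deadlock: a deliverable message always enables \<open>adopt\<close>,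
  \<open>ignore\<close> or \<open>hear\<close>; with nothing in transit, round 2 can start, and
  after that every undecided vertex can decide.\<close>

lemma stuck_imp_terminated:
  assumes ok: "config_ok c" and stuck: "\<nexists>c'. step G c c'"
  shows "terminated G c"
proof -
  have empty: "transit c = {#}"
  proof (rule ccontr)
    assume "transit c \<noteq> {#}"
    then obtain m t where mt: "can_arrive c m t"
      using ok message_can_arrive unfolding config_ok_def by blast
    obtain u v x t0 where m: "m = Message u v x t0"
      by (cases m)
    show False
    proof (cases x)
      case (Infrastructure l)
      then show False
        using stuck adopt[OF mt] ignore[OF mt] m by blast
    next
      case (Level l)
      then show False
        using stuck hear[OF mt] m by blast
    qed
  qed
  then have r: "round_two c"
    using stuck start_round_two by blast
  have "in_cover (node c v) \<noteq> None" if v: "v \<in> pverts G" for v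
  proof
    assume "in_cover (node c v) = None"
    \<comment> \<open>The invariant speaks of arcs into \<open>v\<close>, \<open>neighbors\<close>
      of arcs out of \<open>v\<close>; symmetry connects them.\<close>
    moreover have "\<forall>u \<in> neighbors G v. heard (node c v) u \<noteq> None"
      using ok r empty arc_sym by (auto simp: config_ok_def round_two_ok_def)
    ultimately show False
      using stuck decide[OF r v] by blast
  qed
  then show ?thesis
    using r empty by (simp add: terminated_def)
qed

text \<open>Lexicographic measure. Levels come first because an adoption sends new messages, and the
  round flag precedes the message count because starting round 2 fills the network. A multiset copes
  with infinite levels, where a sum would not decrease.\<close>

definition progress :: "config \<Rightarrow> enat multiset \<times> nat \<times> nat" where
  "progress c =
     (image_mset (\<lambda>v. level (node c v)) (mset_set (pverts G)),
      if round_two c then 0 else 1,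
      size (transit c) + card {v \<in> pverts G. in_cover (node c v) = None})"

definition progress_order :: "((enat multiset \<times> nat \<times> nat) \<times> (enat multiset \<times> nat \<times> nat)) set" where
  "progress_order = {(M, N). M < N} <*lex*> less_than <*lex*> less_than"

lemma wf_progress_order: "wf progress_order"
  unfolding progress_order_def by (intro wf_lex_prod wf_less_multiset wf_less_than)

lemma step_progress:
  assumes "step G c c'" "config_ok c"
  shows "(progress c', progress c) \<in> progress_order"
  using assms
proof cases
  case (adopt m t u v l t0)
  have v: "v \<in> pverts G"
    using can_arriveD(1)[OF adopt(2)] adopt(3) assms(2) arc_in_verts
    unfolding config_ok_def links_ok_def by blast
  \<comment> \<open>Isolating \<open>v\<close> shows that the new multiset replaces a single element
    by a smaller one.\<close>
  have split: "mset_set (pverts G) = add_mset v (mset_set (pverts G - {v}))"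
    using v by (simp add: mset_set.remove)
  have "image_mset (\<lambda>w. level (node c' w)) (mset_set (pverts G - {v}))
      = image_mset (\<lambda>w. level (node c w)) (mset_set (pverts G - {v}))"
    by (intro image_mset_cong) (auto simp: adopt(1))
  then have "image_mset (\<lambda>w. level (node c' w)) (mset_set (pverts G))
      < image_mset (\<lambda>w. level (node c w)) (mset_set (pverts G))"
    using adopt(4) by (simp add: split) (simp add: adopt(1))
  then show ?thesis
    by (simp add: progress_def progress_order_def)
next
  case (ignore m t u v l t0)
  have "size (transit c') < size (transit c)"
    using can_arriveD(1)[OF ignore(2)] by (simp add: ignore(1) size_Diff1_less)
  then show ?thesis
    by (simp add: progress_def progress_order_def ignore(1))
next
  case start_round_two
  then show ?thesis
    by (simp add: progress_def progress_order_def)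
next
  case (hear m t u v l t0)
  have "image_mset (\<lambda>w. level (node c' w)) (mset_set (pverts G))
      = image_mset (\<lambda>w. level (node c w)) (mset_set (pverts G))"
    by (intro image_mset_cong) (auto simp: hear(1))
  moreover have "{w \<in> pverts G. in_cover (node c' w) = None} = {w \<in> pverts G. in_cover (node c w) = None}"
    by (auto simp: hear(1))
  moreover have "size (transit c') < size (transit c)"
    using can_arriveD(1)[OF hear(2)] by (simp add: hear(1) size_Diff1_less)
  ultimately show ?thesis
    by (simp add: progress_def progress_order_def hear(1))
next
  case (decide v)
  have "image_mset (\<lambda>w. level (node c' w)) (mset_set (pverts G))
      = image_mset (\<lambda>w. level (node c w)) (mset_set (pverts G))"
    by (intro image_mset_cong) (auto simp: decide(1))
  moreover have "card {w \<in> pverts G. in_cover (node c' w) = None}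
      < card {w \<in> pverts G. in_cover (node c w) = None}"
    using decide by (intro psubset_card_mono) (auto split: if_splits)
  ultimately show ?thesis
    by (simp add: progress_def progress_order_def decide(1))
qed

section \<open>Termination and running time of executions\<close>

lemma execution_config_ok:
  assumes "execution G sink \<sigma>"
  shows "config_ok (\<sigma> i)"
proof (induction i)
  case 0
  then show ?case
    using assms config_ok_initial by (simp add: execution_def)
next
  case (Suc i)
  then show ?case
    using assms config_ok_step unfolding execution_def by metis
qed

text \<open>Without termination no configuration is stuck, so the execution never stutters and its
  measures form an infinite descending chain.\<close>

lemma execution_terminates:
  assumes "execution G sink \<sigma>"
  shows "\<exists>i. terminated G (\<sigma> i)"
proof (rule ccontr)
  assume "\<nexists>i. terminated G (\<sigma> i)"
  then have "step G (\<sigma> i) (\<sigma> (Suc i))" for i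
    using assms stuck_imp_terminated execution_config_ok[OF assms]
    unfolding execution_def by metis
  then have "(progress (\<sigma> (Suc i)), progress (\<sigma> i)) \<in> progress_order" for i
    using step_progress execution_config_ok[OF assms] by blast
  then have "\<exists>f. \<forall>i. (f (Suc i), f i) \<in> progress_order"
    by (intro exI[of _ "\<lambda>i. progress (\<sigma> i)"]) simp
  then show False
    using wf_progress_order unfolding wf_iff_no_infinite_down_chain by blast
qed

lemma running_time_le:
  assumes "execution G sink \<sigma>"
  shows "running_time G \<sigma> \<le> ennreal (card (pverts G) + 1)"
  unfolding running_time_def
  using execution_terminates[OF assms] clock_bound[OF execution_config_ok[OF assms]]
  by (auto intro: ennreal_leI simp del: ennreal_plus)

end

section \<open>The linear bound\<close>

lemma worst_case_time_le: "worst_case_time n \<le> ennreal (real n + 1)"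
  unfolding worst_case_time_def
proof (rule SUP_least, clarify)
  fix G s \<sigma>
  assume net: "sensor_network G s" and ex: "execution G s \<sigma>"
  show "running_time G \<sigma> \<le> ennreal (real (card (pverts G)) + 1)"
    using sensor_network.running_time_le[OF net ex] by (simp add: add.commute)
qed

text \<open>\<open>enn2real\<close> sends \<infinity> to 0, so finiteness is stated separately from
  the growth rate.\<close>

theorem theorem7:
  shows "(\<forall>n. worst_case_time n \<noteq> \<infinity>) \<and>
    (\<lambda>n. enn2real (worst_case_time n)) \<in> O(\<lambda>n. real n)"
proof
  show "\<forall>n. worst_case_time n \<noteq> \<infinity>"
    using worst_case_time_le by (metis ennreal_neq_top infinity_ennreal_def top.extremum_uniqueI)
  have bound: "enn2real (worst_case_time n) \<le> real n + 1" for n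
    using worst_case_time_le[of n] by (intro enn2real_leI) auto
  show "(\<lambda>n. enn2real (worst_case_time n)) \<in> O(\<lambda>n. real n)"
  \<comment> \<open>\<open>n + 1 \<le> 2 * n\<close> as soon as \<open>n \<ge> 1\<close>.\<close>
  proof (rule bigoI[where c = 2])
    show "\<forall>\<^sub>F n in sequentially. norm (enn2real (worst_case_time n)) \<le> 2 * norm (real n)"
      using eventually_ge_at_top[of 1]
    proof eventually_elim
      case (elim n)
      then show ?case
        using bound[of n] by simp
    qed
  qed
qed

end
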